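(* Let $(p_n)_{n\geqslant 0}$ and $(q_n)_{n\geqslant 0}$ be real sequences with $p_0>0$, $q_0>0$ and $p_n\geqslant 0$, $q_n\geqslant 0$ for all $n>0$, and suppose that the Nörlund methods $(N,p)$ and $(N,q)$ are finite, i.e. $\sum_{n\geqslant 0}p_n<\infty$ and $\sum_{n\geqslant 0}q_n<\infty$. Let $(k_n)_{n\geqslant 0}$ and $(l_n)_{n\geqslant 0}$ be the unique real sequences satisfying, for all $n\geqslant 0$, $$q_n=k_0p_n+k_1p_{n-1}+\cdots+k_np_0,\qquad p_n=l_0q_n+l_1q_{n-1}+\cdots+l_nq_0,$$ and let $[q:p]=\sum_{n\geqslant 0}|k_n|\in[0,\infty]$ and $[p:q]=\sum_{n\geqslant 0}|l_n|\in[0,\infty]$. Then $(N,p)$ and $(N,q)$ are equivalent if and only if both $[q:p]<\infty$ and $[p:q]<\infty$.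
   Context: Let $(p_n)_{n\geqslant 0}$ be a real sequence with $p_0>0$ and $p_n\geqslant 0$ for $n>0$, and let $P_m=p_0+\cdots+p_m$. The Nörlund method $(N,p)$ associates to each sequence $s=(s_n)_{n\geqslant 0}$ of complex numbers the sequence $(t_m)_{m\geqslant 0}$ given by $$t_m=\frac{1}{P_m}\sum_{n=0}^m p_{m-n}s_n .$$ The sequence $s$ is $(N,p)$-convergent to $\sigma$ if $t_m\to\sigma$ in the ordinary sense as $m\to\infty$. A series is $(N,p)$-summable with sum $\sigma$ if its sequence of partial sums is $(N,p)$-convergent to $\sigma$. The same definitions apply to $(N,q)$. The method $(N,p)$ is called finite if $\sum_{n\geqslant 0}p_n$ converges. One summation method includes a second if every series summable by the second is summable by the first to the same sum; for Nörlund methods, $(N,q)$ includes $(N,p)$ exactly when every sequence that is $(N,p)$-convergent to some $\sigma$ is $(N,q)$-convergent to the same $\sigma$. Two summation methods are equivalent if each includes the other. The sequences $(k_n)$ and $(l_n)$ are determined recursively by their defining convolution systems since $p_0\neq 0$ and $q_0\neq 0$. *)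

theory Defs
  imports "HOL-Analysis.Analysis"
begin

definition norlund_weight :: "(nat \<Rightarrow> real) \<Rightarrow> bool" where
  "norlund_weight p \<longleftrightarrow> p 0 > 0 \<and> (\<forall>n>0. p n \<ge> 0)"

definition norlund_mean :: "(nat \<Rightarrow> real) \<Rightarrow> (nat \<Rightarrow> complex) \<Rightarrow> nat \<Rightarrow> complex" where
  "norlund_mean p s m =
     1 / of_real (\<Sum>n\<le>m. p n) * (\<Sum>n\<le>m. of_real (p (m - n)) * s n)"

definition norlund_converges :: "(nat \<Rightarrow> real) \<Rightarrow> (nat \<Rightarrow> complex) \<Rightarrow> complex \<Rightarrow> bool" where
  "norlund_converges p s \<sigma> \<longleftrightarrow> norlund_mean p s \<longlonglongrightarrow> \<sigma>"

definition norlund_sums :: "(nat \<Rightarrow> real) \<Rightarrow> (nat \<Rightarrow> complex) \<Rightarrow> complex \<Rightarrow> bool" where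
  "norlund_sums p a \<sigma> \<longleftrightarrow> norlund_converges p (\<lambda>n. \<Sum>i\<le>n. a i) \<sigma>"

definition norlund_finite :: "(nat \<Rightarrow> real) \<Rightarrow> bool" where
  "norlund_finite p \<longleftrightarrow> summable p"

text \<open>
  A summation method is represented by the relation ``the series with terms \<open>a\<close> is summable
  with sum \<open>\<sigma>\<close>''.  The first argument of \<open>method_includes\<close> is the stronger method.
\<close>

type_synonym summation_method = "(nat \<Rightarrow> complex) \<Rightarrow> complex \<Rightarrow> bool"

definition method_includes :: "summation_method \<Rightarrow> summation_method \<Rightarrow> bool" where
  "method_includes V W \<longleftrightarrow> (\<forall>a \<sigma>. W a \<sigma> \<longrightarrow> V a \<sigma>)"

definition methods_equivalent :: "summation_method \<Rightarrow> summation_method \<Rightarrow> bool" where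
  "methods_equivalent V W \<longleftrightarrow> method_includes V W \<and> method_includes W V"

text \<open>For the methods at hand, inclusion may be tested on sequences instead of series.\<close>

lemma method_includes_norlund_iff:
  "method_includes (norlund_sums q) (norlund_sums p) \<longleftrightarrow>
     (\<forall>s \<sigma>. norlund_converges p s \<sigma> \<longrightarrow> norlund_converges q s \<sigma>)"
proof -
  have partial: "\<exists>a. (\<lambda>n. \<Sum>i\<le>n. a i) = s" for s :: "nat \<Rightarrow> complex"
  proof
    let ?a = "\<lambda>i. if i = 0 then s 0 else s i - s (i - 1)"
    have "(\<Sum>i\<le>n. ?a i) = s n" for n
      by (induction n) auto
    then show "(\<lambda>n. \<Sum>i\<le>n. ?a i) = s" by auto
  qed
  show ?thesis
    unfolding method_includes_def norlund_sums_def by (metis partial)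
qed

text \<open>The sequence of coefficients of the formal power series quotient $q(x)/p(x)$.\<close>

definition convolution_quotient ::
    "(nat \<Rightarrow> real) \<Rightarrow> (nat \<Rightarrow> real) \<Rightarrow> (nat \<Rightarrow> real) \<Rightarrow> bool" where
  "convolution_quotient q p k \<longleftrightarrow> (\<forall>n. q n = (\<Sum>i\<le>n. k i * p (n - i)))"

lemma convolution_quotient_ex1:
  assumes "p 0 \<noteq> 0"
  shows "\<exists>!k. convolution_quotient q p k"
proof -
  have iff: "convolution_quotient q p k \<longleftrightarrow> Abs_fps q = Abs_fps k * Abs_fps p" for k
    by (simp add: convolution_quotient_def fps_eq_iff fps_mult_nth atLeast0AtMost)
  have p0: "fps_nth (Abs_fps p) 0 \<noteq> 0" using assms by simp
  show ?thesis
  proof (rule ex1I)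
    show "convolution_quotient q p (fps_nth (Abs_fps q * inverse (Abs_fps p)))"
      unfolding iff fps_nth_inverse
      using inverse_mult_eq_1[OF p0] by (simp add: mult.assoc)
  next
    fix k assume "convolution_quotient q p k"
    then have "Abs_fps q * inverse (Abs_fps p) = Abs_fps k"
      unfolding iff using inverse_mult_eq_1'[OF p0] by (simp add: mult.assoc)
    then show "k = fps_nth (Abs_fps q * inverse (Abs_fps p))"
      by (simp add: fun_eq_iff)
  qed
qed

definition abs_series :: "(nat \<Rightarrow> real) \<Rightarrow> ennreal" where
  "abs_series k = (\<Sum>n. ennreal \<bar>k n\<bar>)"

end

theory Submission
  imports Defs
begin

text \<open>
  Let \<open>T = p * s\<close> and \<open>U = q * s\<close> denote convolutions.  Since \<open>p 0 \<noteq> 0\<close>, the sequence \<open>T\<close>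
  is arbitrary, and \<open>U = k * T\<close>.  For finite methods the denominators of the means converge to
  positive limits, so inclusion says that convolution with \<open>k\<close> maps each sequence with limit
  \<open>L * (\<Sum>n. p n)\<close> to one with limit \<open>L * (\<Sum>n. q n)\<close>.  If \<open>k\<close> is absolutely summable this
  holds by Tannery's theorem and \<open>(\<Sum>n. k n) * (\<Sum>n. p n) = (\<Sum>n. q n)\<close>.  Otherwise a gliding
  hump yields a null sequence whose convolution with \<open>k\<close> does not tend to \<open>0\<close>.
\<close>

lemma convolution_tendsto:
  fixes k x :: "nat \<Rightarrow> 'a::{real_normed_field, banach}"
  assumes k: "summable (\<lambda>n. norm (k n))" and x: "x \<longlonglongrightarrow> L"
  shows "(\<lambda>m. \<Sum>i\<le>m. k i * x (m - i)) \<longlonglongrightarrow> (\<Sum>i. k i) * L"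
proof -
  \<comment> \<open>Padding with zeros for \<open>i > m\<close> turns the finite sums into series
    over one fixed index set, with the summable majorant \<open>norm (k i) * M\<close>.\<close>
  define a where "a i m = (if i \<le> m then k i * x (m - i) else 0)" for i m
  obtain M where M: "\<And>n. norm (x n) \<le> M"
    using x convergent_imp_Bseq[of x] by (auto simp: convergent_def Bseq_def)
  have M0: "0 \<le> M" using M[of 0] norm_ge_zero order_trans by blast
  have a_lim: "(\<lambda>m. a i m) \<longlonglongrightarrow> k i * L" for i
  proof -
    have "(\<lambda>m. a i (m + i)) \<longlonglongrightarrow> k i * L"
      unfolding a_def using x by (auto intro: tendsto_intros)
    then show ?thesis by (rule LIMSEQ_offset)
  qed
  have bound: "norm (a i m) \<le> norm (k i) * M" for i m
    unfolding a_def using M M0 by (auto simp: norm_mult intro!: mult_left_mono)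
  have "(\<lambda>m. \<Sum>i. a i m) \<longlonglongrightarrow> (\<Sum>i. k i * L)"
    by (rule tannerys_theorem[THEN conjunct2, THEN conjunct2, OF a_lim])
      (auto intro!: always_eventually bound summable_mult2 k)
  moreover have "(\<Sum>i. a i m) = (\<Sum>i\<le>m. k i * x (m - i))" for m
  proof -
    have "(\<Sum>i. a i m) = (\<Sum>i\<le>m. a i m)"
      by (rule suminf_finite) (auto simp: a_def)
    then show ?thesis by (simp add: a_def)
  qed
  moreover have "(\<Sum>i. k i * L) = (\<Sum>i. k i) * L"
    using suminf_mult2[OF summable_norm_cancel[OF k]] by simp
  ultimately show ?thesis by simp
qed

text \<open>This picks the next block end \<open>m\<close> after \<open>M\<close>. In the
  convolution at \<open>m\<close>, indices below \<open>m - M\<close> meet the new entries of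
  \<open>x\<close>, while the last \<open>M + 1\<close> meet the entries up to \<open>M\<close>,
  already fixed. Divergence makes the first group heavy; nullness of \<open>k\<close> makes a far
  window of fixed length light.\<close>

lemma gliding_hump_step:
  fixes k :: "nat \<Rightarrow> real"
  assumes k: "\<not> summable (\<lambda>n. \<bar>k n\<bar>)" and null: "k \<longlonglongrightarrow> 0"
  shows "\<exists>m>M. B \<le> (\<Sum>i<m - M. \<bar>k i\<bar>) \<and> (\<Sum>i=m - M..m. \<bar>k i\<bar>) \<le> 1"
proof -
  obtain N where N: "B \<le> (\<Sum>i<N. \<bar>k i\<bar>)"
    using summableI_nonneg_bounded[of "\<lambda>n. \<bar>k n\<bar>" B] k by (meson abs_ge_zero linear)
  have "\<forall>\<^sub>F n in sequentially. \<bar>k n\<bar> < 1 / (M + 1)"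
    using tendstoD[OF null, of "1 / (M + 1)"] by simp
  then obtain N' where N': "\<And>n. n \<ge> N' \<Longrightarrow> \<bar>k n\<bar> < 1 / (M + 1)"
    by (auto simp: eventually_sequentially)
  \<comment> \<open>Now \<open>m - M\<close> exceeds both \<open>N\<close> and \<open>N'\<close>:
    the head contains the first \<open>N\<close> terms and the whole window lies beyond
    \<open>N'\<close>.\<close>
  define m where "m = M + N + N' + 1"
  have "(\<Sum>i<N. \<bar>k i\<bar>) \<le> (\<Sum>i<m - M. \<bar>k i\<bar>)"
    by (rule sum_mono2) (auto simp: m_def)
  moreover have "(\<Sum>i=m - M..m. \<bar>k i\<bar>) \<le> of_nat (card {m - M..m}) * (1 / (M + 1))"
    by (rule sum_bounded_above) (auto simp: m_def intro!: less_imp_le N'[simplified])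
  moreover have "card {m - M..m} = M + 1" by (simp add: m_def)
  ultimately show ?thesis
    using N by (intro exI[of _ m]) (auto simp: m_def)
qed

lemma gliding_hump:
  fixes k :: "nat \<Rightarrow> real"
  assumes k: "\<not> summable (\<lambda>n. \<bar>k n\<bar>)" and null: "k \<longlonglongrightarrow> 0"
  shows "\<exists>x. x \<longlonglongrightarrow> 0 \<and> \<not> (\<lambda>m. \<Sum>i\<le>m. k i * x (m - i)) \<longlonglongrightarrow> 0"
proof -
  \<comment> \<open>The factor \<open>real j + 1\<close> offsets the size of \<open>x\<close> on
    block \<open>j\<close>. A head of at least 2 against a window of at most 1 leaves at least
    1.\<close>
  define hump where "hump j M m \<longleftrightarrow> M < m \<and> 2 * (real j + 1) \<le> (\<Sum>i<m - M. \<bar>k i\<bar>)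
    \<and> (\<Sum>i=m - M..m. \<bar>k i\<bar>) \<le> 1" for j M m
  have "\<exists>m. \<forall>j. True \<and> hump (Suc j) (m j) (m (Suc j))"
    by (rule dependent_nat_choice) (use gliding_hump_step[OF k null] in \<open>auto simp: hump_def\<close>)
  then obtain m where m: "\<And>j. hump (Suc j) (m j) (m (Suc j))" by blast
  have mono: "strict_mono m"
    using m by (auto simp: strict_mono_Suc_iff hump_def)
  \<comment> \<open>\<open>J n\<close> is the number of the block containing \<open>n\<close>,
    namely the block that ends at \<open>m (J n)\<close>; block 0 is everything up to
    \<open>m 0\<close>.\<close>
  define J where "J n = (LEAST j. n \<le> m j)" for n
  have J_le: "n \<le> m (J n)" for n
    unfolding J_def by (rule LeastI[of _ n]) (rule strict_mono_imp_increasing[OF mono])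
  \<comment> \<open>In the convolution evaluated at \<open>m (J n)\<close>, the entry
    \<open>x n\<close> is multiplied by \<open>k (m (J n) - n)\<close>. Matching its sign prevents
    cancellation inside the block, and the divisor makes \<open>x\<close> null.\<close>
  define x where "x n = sgn (k (m (J n) - n)) / (real (J n) + 1)" for n
  have J_top: "filterlim J at_top sequentially"
    unfolding filterlim_at_top eventually_sequentially
  proof (intro allI exI impI)
    fix Z n assume "m Z \<le> n"
    then have "m Z \<le> m (J n)" using J_le[of n] by linarith
    then show "Z \<le> J n" using mono by (simp add: strict_mono_less_eq)
  qed
  have x_abs: "\<bar>x n\<bar> \<le> 1 / (real (J n) + 1)" for n
    by (auto simp: x_def sgn_if)
  have x_le1: "\<bar>x n\<bar> \<le> 1" for n
    using x_abs[of n] by (rule order_trans) simp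
  have "(\<lambda>n. 1 / (real (J n) + 1)) \<longlonglongrightarrow> 0"
    using filterlim_compose[OF LIMSEQ_inverse_real_of_nat J_top]
    by (simp add: inverse_eq_divide add.commute)
  then have x0: "x \<longlonglongrightarrow> 0"
    by (rule Lim_null_comparison[rotated]) (simp add: x_abs)
  have big: "1 \<le> (\<Sum>i\<le>m (Suc j). k i * x (m (Suc j) - i))" for j
  proof -
    let ?M = "m j" and ?m = "m (Suc j)"
    have h: "?M < ?m" "2 * (real (Suc j) + 1) \<le> (\<Sum>i<?m - ?M. \<bar>k i\<bar>)"
        "(\<Sum>i=?m - ?M..?m. \<bar>k i\<bar>) \<le> 1"
      using m[of j] by (auto simp: hump_def)
    have J_eq: "J n = Suc j" if "?M < n" "n \<le> ?m" for n
      unfolding J_def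
    proof (rule Least_equality, fact that(2))
      fix i assume "n \<le> m i"
      then have "m j < m i" using that by linarith
      then show "Suc j \<le> i" using mono by (simp add: strict_mono_less)
    qed
    have split: "{..?m} = {..<?m - ?M} \<union> {?m - ?M..?m}" by auto
    have "(\<Sum>i<?m - ?M. k i * x (?m - i)) = (\<Sum>i<?m - ?M. \<bar>k i\<bar> / (real (Suc j) + 1))"
    proof (rule sum.cong)
      fix i assume "i \<in> {..<?m - ?M}"
      then have "J (?m - i) = Suc j" "?m - (?m - i) = i" using h(1) by (auto intro!: J_eq)
      then show "k i * x (?m - i) = \<bar>k i\<bar> / (real (Suc j) + 1)"
        by (simp add: x_def abs_sgn)
    qed simp
    also have "\<dots> = (\<Sum>i<?m - ?M. \<bar>k i\<bar>) / (real (Suc j) + 1)"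
      by (simp add: sum_divide_distrib)
    also have "\<dots> \<ge> 2" using h(2) by (simp add: field_simps)
    finally have "2 \<le> (\<Sum>i<?m - ?M. k i * x (?m - i))" .
    \<comment> \<open>For the earlier blocks the signs are uncontrolled, so only the crude bound 1
      on \<open>x\<close> is used.\<close>
    moreover have "\<bar>\<Sum>i=?m - ?M..?m. k i * x (?m - i)\<bar> \<le> (\<Sum>i=?m - ?M..?m. \<bar>k i\<bar>)"
      by (rule order_trans[OF sum_abs sum_mono]) (simp add: abs_mult mult_left_le x_le1)
    ultimately show ?thesis
      unfolding split using h(3) by (subst sum.union_disjoint) auto
  qed
  have "\<not> (\<lambda>m. \<Sum>i\<le>m. k i * x (m - i)) \<longlonglongrightarrow> 0"
  proof
    assume "(\<lambda>m. \<Sum>i\<le>m. k i * x (m - i)) \<longlonglongrightarrow> 0"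
    then have "(\<lambda>j. \<Sum>i\<le>m (Suc j). k i * x (m (Suc j) - i)) \<longlonglongrightarrow> 0"
      using LIMSEQ_subseq_LIMSEQ[OF _ mono] LIMSEQ_Suc by (fastforce simp: o_def)
    then show False using big LIMSEQ_le_const[of _ 0 1] by force
  qed
  with x0 show ?thesis by blast
qed

text \<open>Weights are real but sequences complex; in the ring of complex power series convolutions
  become products that can be reassociated and inverted.\<close>

definition fps_complex :: "(nat \<Rightarrow> real) \<Rightarrow> complex fps" where
  "fps_complex p = Abs_fps (\<lambda>n. of_real (p n))"

lemma convolution_quotient_fps_complex:
  "convolution_quotient q p k \<Longrightarrow> fps_complex q = fps_complex k * fps_complex p"
  unfolding convolution_quotient_def fps_complex_def
  by (rule fps_ext) (simp only: fps_nth_Abs_fps fps_mult_nth atLeast0AtMost of_real_sum of_real_mult)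

lemma norlund_weight_nonneg: "norlund_weight p \<Longrightarrow> 0 \<le> p n"
  by (cases n) (auto simp: norlund_weight_def)

lemma norlund_weight_suminf_pos:
  "norlund_weight p \<Longrightarrow> summable p \<Longrightarrow> 0 < suminf p"
  by (rule suminf_pos2[of _ 0]) (auto simp: norlund_weight_nonneg norlund_weight_def)

lemma norlund_converges_iff:
  assumes p: "norlund_weight p" and fin: "summable p"
  shows "norlund_converges p s \<sigma> \<longleftrightarrow>
    fps_nth (fps_complex p * Abs_fps s) \<longlonglongrightarrow> of_real (suminf p) * \<sigma>"
proof -
  let ?P = "\<lambda>m. complex_of_real (\<Sum>n\<le>m. p n)"
  let ?T = "fps_nth (fps_complex p * Abs_fps s)"
  have T: "?T m = (\<Sum>n\<le>m. of_real (p (m - n)) * s n)" for m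
    \<comment> \<open>Commuting the factors makes the summation index that of \<open>s\<close>, as
      in \<open>norlund_mean\<close>.\<close>
    by (subst mult.commute) (simp add: fps_mult_nth fps_complex_def atLeast0AtMost mult.commute)
  have pos: "0 < (\<Sum>n\<le>m. p n)" for m
    using p by (intro sum_pos2[of _ 0]) (auto simp: norlund_weight_nonneg norlund_weight_def)
  have P0: "?P m \<noteq> 0" for m
    using pos[of m] by (simp only: of_real_eq_0_iff)
  have mean: "norlund_mean p s m = ?T m / ?P m" for m
    by (simp add: norlund_mean_def T)
  have P: "?P \<longlonglongrightarrow> of_real (suminf p)"
    by (intro tendsto_of_real summable_LIMSEQ' fin)
  have Plim: "complex_of_real (suminf p) \<noteq> 0"
    using norlund_weight_suminf_pos[OF p fin] by simp
  show ?thesis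
    unfolding norlund_converges_def
  proof
    assume "norlund_mean p s \<longlonglongrightarrow> \<sigma>"
    from tendsto_mult[OF P this] show "?T \<longlonglongrightarrow> of_real (suminf p) * \<sigma>"
      using P0 by (simp add: mean del: of_real_sum)
  next
    assume "?T \<longlonglongrightarrow> of_real (suminf p) * \<sigma>"
    from tendsto_divide[OF this P Plim] show "norlund_mean p s \<longlonglongrightarrow> \<sigma>"
      using Plim by (simp add: mean[abs_def] del: of_real_sum)
  qed
qed

lemma method_includes_norlund_iff_convolution:
  assumes p: "norlund_weight p" "summable p" and q: "norlund_weight q" "summable q"
    and k: "convolution_quotient q p k"
  shows "method_includes (norlund_sums q) (norlund_sums p) \<longleftrightarrow>
    (\<forall>x (\<sigma>::complex). x \<longlonglongrightarrow> of_real (suminf p) * \<sigma> \<longrightarrow>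
      (\<lambda>m. \<Sum>i\<le>m. of_real (k i) * x (m - i)) \<longlonglongrightarrow> of_real (suminf q) * \<sigma>)"
proof -
  have conv: "fps_nth (fps_complex k * F) = (\<lambda>m. \<Sum>i\<le>m. of_real (k i) * fps_nth F (m - i))"
    for F
    by (simp add: fps_mult_nth fps_complex_def atLeast0AtMost fun_eq_iff)
  have qs: "fps_complex q * F = fps_complex k * (fps_complex p * F)" for F
    by (simp add: convolution_quotient_fps_complex[OF k] mult.assoc)
  have p0: "fps_nth (fps_complex p) 0 \<noteq> 0"
    using p(1) by (simp add: fps_complex_def norlund_weight_def)
  \<comment> \<open>The witness is the power series quotient of \<open>x\<close> by
    \<open>p\<close>.\<close>
  have surj: "\<exists>s. fps_nth (fps_complex p * Abs_fps s) = x" for x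
  proof
    show "fps_nth (fps_complex p * Abs_fps (fps_nth (inverse (fps_complex p) * Abs_fps x))) = x"
      using inverse_mult_eq_1'[OF p0]
      by (simp add: fps_nth_inverse mult.assoc[symmetric] fun_eq_iff)
  qed
  show ?thesis
    unfolding method_includes_norlund_iff norlund_converges_iff[OF p] norlund_converges_iff[OF q]
      qs conv
  proof (intro iffI allI impI)
    fix x :: "nat \<Rightarrow> complex" and \<sigma>
    assume incl: "\<forall>s \<sigma>. fps_nth (fps_complex p * Abs_fps s) \<longlonglongrightarrow> of_real (suminf p) * \<sigma> \<longrightarrow>
        (\<lambda>m. \<Sum>i\<le>m. of_real (k i) * fps_nth (fps_complex p * Abs_fps s) (m - i))
          \<longlonglongrightarrow> of_real (suminf q) * \<sigma>"
      and x: "x \<longlonglongrightarrow> of_real (suminf p) * \<sigma>"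
    obtain s where s: "fps_nth (fps_complex p * Abs_fps s) = x" using surj by blast
    show "(\<lambda>m. \<Sum>i\<le>m. of_real (k i) * x (m - i)) \<longlonglongrightarrow> of_real (suminf q) * \<sigma>"
      using incl[rule_format, of s \<sigma>] x unfolding s by blast
  qed blast
qed

lemma method_includes_norlund_iff_abs_summable:
  assumes p: "norlund_weight p" "summable p" and q: "norlund_weight q" "summable q"
    and k: "convolution_quotient q p k"
  shows "method_includes (norlund_sums q) (norlund_sums p) \<longleftrightarrow> summable (\<lambda>n. \<bar>k n\<bar>)"
proof
  assume "method_includes (norlund_sums q) (norlund_sums p)"
  then have "(\<lambda>m. \<Sum>i\<le>m. of_real (k i) * x (m - i)) \<longlonglongrightarrow> of_real (suminf q) * \<sigma>"
    if "x \<longlonglongrightarrow> of_real (suminf p) * \<sigma>" for x :: "nat \<Rightarrow> complex" and \<sigma>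
    using that unfolding method_includes_norlund_iff_convolution[OF assms] by blast
  \<comment> \<open>With \<sigma> = 0 both limits vanish, leaving the statement that convolution
    with \<open>k\<close> preserves null sequences.\<close>
  from this[where \<sigma> = 0]
  have complex_null: "(\<lambda>m. \<Sum>i\<le>m. of_real (k i) * x (m - i)) \<longlonglongrightarrow> 0"
    if "x \<longlonglongrightarrow> 0" for x :: "nat \<Rightarrow> complex"
    using that by simp
  \<comment> \<open>The gliding hump is real, so the property is restricted to real
    sequences.\<close>
  have null: "(\<lambda>m. \<Sum>i\<le>m. k i * x (m - i)) \<longlonglongrightarrow> 0" if "x \<longlonglongrightarrow> 0" for x
  proof -
    have "(\<lambda>m. complex_of_real (\<Sum>i\<le>m. k i * x (m - i))) \<longlonglongrightarrow> of_real 0"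
      using complex_null[of "\<lambda>n. of_real (x n)"] tendsto_of_real[OF that, where 'a = complex]
      by simp
    then show ?thesis by (simp only: tendsto_of_real_iff)
  qed
  \<comment> \<open>Convolution with the unit sequence returns \<open>k\<close>, so \<open>k\<close>
    is null, as \<open>gliding_hump\<close> requires.\<close>
  let ?e = "\<lambda>n. if n = 0 then 1 else 0 :: real"
  have "?e \<longlonglongrightarrow> 0"
    by (rule tendsto_eventually) (auto simp: eventually_sequentially intro!: exI[of _ 1])
  moreover have "(\<Sum>i\<le>m. k i * ?e (m - i)) = k m" for m
  proof -
    have "(\<Sum>i\<le>m. k i * ?e (m - i)) = (\<Sum>i\<le>m. if i = m then k i else 0)"
      by (rule sum.cong) auto
    then show ?thesis by simp
  qed
  ultimately have "k \<longlonglongrightarrow> 0" using null[of ?e] by simp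
  then show "summable (\<lambda>n. \<bar>k n\<bar>)" using gliding_hump null by blast
next
  assume sum: "summable (\<lambda>n. \<bar>k n\<bar>)"
  \<comment> \<open>The Cauchy product identifies the limit: multiplying by \<open>suminf k\<close>
    turns \<open>suminf p\<close> into \<open>suminf q\<close>.\<close>
  have "(\<lambda>n. \<Sum>i\<le>n. k i * p (n - i)) sums (suminf k * suminf p)"
    by (rule Cauchy_product_sums) (simp_all add: sum p norlund_weight_nonneg)
  moreover have "(\<lambda>n. \<Sum>i\<le>n. k i * p (n - i)) = q"
    by (rule ext) (rule k[unfolded convolution_quotient_def, THEN spec, symmetric])
  ultimately have "q sums (suminf k * suminf p)" by simp
  then have Q: "suminf q = suminf k * suminf p" by (simp add: sums_iff)
  have "(\<lambda>m. \<Sum>i\<le>m. of_real (k i) * x (m - i)) \<longlonglongrightarrow> of_real (suminf q) * \<sigma>"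
    if "x \<longlonglongrightarrow> of_real (suminf p) * \<sigma>" for x :: "nat \<Rightarrow> complex" and \<sigma>
  proof -
    have "(\<Sum>i. complex_of_real (k i)) = of_real (suminf k)"
      by (rule suminf_of_real[OF summable_rabs_cancel[OF sum], symmetric])
    moreover have "(\<lambda>m. \<Sum>i\<le>m. of_real (k i) * x (m - i)) \<longlonglongrightarrow>
        (\<Sum>i. of_real (k i)) * (of_real (suminf p) * \<sigma>)"
      by (rule convolution_tendsto) (simp_all add: sum that)
    ultimately show ?thesis by (simp only: Q of_real_mult mult.assoc)
  qed
  then show "method_includes (norlund_sums q) (norlund_sums p)"
    unfolding method_includes_norlund_iff_convolution[OF assms] by blast
qed

lemma abs_series_finite_iff: "abs_series k < \<infinity> \<longleftrightarrow> summable (\<lambda>n. \<bar>k n\<bar>)"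
  unfolding abs_series_def infinity_ennreal_def less_top[symmetric]
  by (rule iffI, rule summable_suminf_not_top) (simp_all add: ennreal_suminf_neq_top)

theorem theorem3:
  fixes p q k l :: "nat \<Rightarrow> real"
  assumes "norlund_weight p" and "norlund_weight q"
    and "norlund_finite p" and "norlund_finite q"
    and "convolution_quotient q p k"
    and "convolution_quotient p q l"
  shows "methods_equivalent (norlund_sums p) (norlund_sums q) \<longleftrightarrow>
           abs_series k < \<infinity> \<and> abs_series l < \<infinity>"
  \<comment> \<open>The inclusions decouple: \<open>k\<close> decides one, and \<open>l\<close>,
    with the roles of \<open>p\<close> and \<open>q\<close> exchanged, the other.\<close>
  using assms method_includes_norlund_iff_abs_summable[of p q k]
    method_includes_norlund_iff_abs_summable[of q p l]
  unfolding methods_equivalent_def abs_series_finite_iff norlund_finite_def by blast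

end
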